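(* Let $G$ be an Abelian group. Let $K,\varepsilon$ be real numbers with $\varepsilon \in (0,1/2]$, and let $A \subseteq G$ be a finite set with $|A| \ge 2^{32/\varepsilon}$ and $$1 \le K \le \min \Big\{ \Big( 2^{-58} \varepsilon^{-4} \frac{|A|}{\log |A|} \Big)^{(3/2 + \varepsilon)^{-1}},\ |A|^{\varepsilon} \Big\}.$$ Suppose that the number of quadruples $(a_1,a_2,a_3,a_4)\in A^4$ with $a_1 + a_2 = a_3 + a_4$ is at least $|A|^3 / K$. Then there exists a finite set $\Lambda\subseteq G$ such that $$|\mathrm{Span}\, \Lambda \cap A| \ge \frac{1}{2} \cdot \frac{|A|}{K^{1/2 + \varepsilon}} \quad\text{and}\quad |\Lambda| \le 2^{30} \varepsilon^{-2} K \log |A|.$$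
   Context: $\log$ denotes the logarithm to base $2$. For a finite set $E = \{ e_1, \dots, e_{|E|} \} \subseteq G$, $\mathrm{Span}\, E = \{ \sum_{i=1}^{|E|} \varepsilon_i e_i : \varepsilon_i \in \{ -1,0,1 \} \}$. *)

theory Defs
  imports Complex_Main
begin

definition int_mult :: "int \<Rightarrow> 'a::ab_group_add \<Rightarrow> 'a"
  where "int_mult k x =
    (if 0 \<le> k then ((+) x ^^ nat k) 0 else - (((+) x ^^ nat (- k)) 0))"

(* Only meaningful for finite E, since sums over infinite sets are 0 by convention.
   The coefficients are indexed by the elements of E themselves. *)
definition Span :: "'a::ab_group_add set \<Rightarrow> 'a set"
  where "Span E = {(\<Sum>e\<in>E. int_mult (c e) e) | c. \<forall>e\<in>E. c e \<in> {-1, 0, 1}}"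

end

theory Submission
  imports Defs "HOL-Library.Poly_Mapping" "HOL-Analysis.L2_Norm"
begin

text \<open>
  Work in the real group ring of the group, where the additive energy of a finite set is the squared
  \<open>l\<^sup>2\<close>-norm of the square of its indicator. Call a set dissociated if its subset sums are distinct.
  A combinatorial Rudin inequality shows that a dissociated \<open>L\<close> satisfies
  \<open>\<parallel>L * A\<parallel>\<^sup>2 = O(log |A| |L| |A|)\<close>. Remove from \<open>A\<close>, as long as possible, disjoint
  dissociated subsets of size \<open>l\<close>, a large multiple of \<open>K log |A|\<close>: by the triangle inequality the
  removed part \<open>D\<close> has \<open>\<parallel>D * A\<parallel> \<le> \<parallel>A * A\<parallel> / 4\<close>, so the rest \<open>B\<close> has \<open>\<parallel>B * A\<parallel> \<ge> 3/4 \<parallel>A * A\<parallel>\<close>. Together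
  with \<open>\<parallel>B * A\<parallel>\<^sup>2 \<le> \<parallel>B * B\<parallel> \<parallel>A * A\<parallel>\<close> and \<open>\<parallel>B * B\<parallel>\<^sup>2 \<le> |B|\<^sup>3\<close> this gives \<open>|B| \<ge> |A| / (2 K\<^sup>1\<^sup>/\<^sup>3)\<close>,
  which is better than needed. A maximal dissociated subset of \<open>B\<close> has fewer than \<open>l\<close> elements and
  spans \<open>B\<close>.
\<close>

subsection \<open>The real group ring\<close>

lemma poly_mapping_sum_single:
  "(\<Sum>k\<in>Poly_Mapping.keys f. Poly_Mapping.single k (Poly_Mapping.lookup f k)) = f"
proof (rule poly_mapping_eqI)
  fix x
  show "Poly_Mapping.lookup (\<Sum>k\<in>Poly_Mapping.keys f. Poly_Mapping.single k (Poly_Mapping.lookup f k)) x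
      = Poly_Mapping.lookup f x"
    by (auto simp: lookup_sum lookup_single when_def in_keys_iff)
qed

lemma lookup_single_times:
  fixes h :: "'a::ab_group_add \<Rightarrow>\<^sub>0 'b::comm_semiring_1"
  shows "Poly_Mapping.lookup (Poly_Mapping.single k c * h) x = c * Poly_Mapping.lookup h (x - k)"
proof -
  have "Poly_Mapping.single k c * h
      = (\<Sum>j\<in>Poly_Mapping.keys h. Poly_Mapping.single (k + j) (c * Poly_Mapping.lookup h j))"
    by (subst (1) poly_mapping_sum_single [symmetric, of h])
       (simp add: sum_distrib_left mult_single)
  also have "Poly_Mapping.lookup \<dots> x
      = (\<Sum>j\<in>Poly_Mapping.keys h. if j = x - k then c * Poly_Mapping.lookup h j else 0)"
    unfolding lookup_sum
    by (intro sum.cong) (auto simp: lookup_single when_def algebra_simps)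
  also have "\<dots> = c * Poly_Mapping.lookup h (x - k)"
    by (simp add: in_keys_iff)
  finally show ?thesis .
qed

type_synonym 'a group_ring = "'a \<Rightarrow>\<^sub>0 real"

text \<open>The involution induced by negation in the group. Coefficients are real, so no
  conjugation enters, and the coefficient of \<open>f * adj g\<close> at 0 is the inner product of
  \<open>f\<close> and \<open>g\<close>.\<close>

definition adj :: "'a::ab_group_add group_ring \<Rightarrow> 'a group_ring"
  where "adj f = Poly_Mapping.map_key uminus f"

lemma lookup_adj: "Poly_Mapping.lookup (adj f) x = Poly_Mapping.lookup f (- x)"
  by (simp add: adj_def map_key.rep_eq)

lemma adj_single [simp]: "adj (Poly_Mapping.single x c) = Poly_Mapping.single (- x) c"
  by (rule poly_mapping_eqI) (auto simp: lookup_adj lookup_single when_def)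

lemma adj_sum: "adj (\<Sum>i\<in>I. f i) = (\<Sum>i\<in>I. adj (f i))"
  by (rule poly_mapping_eqI) (simp add: lookup_adj lookup_sum)

lemma adj_adj [simp]: "adj (adj f) = f"
  by (rule poly_mapping_eqI) (simp add: lookup_adj)

lemma adj_mult: "adj (f * g) = adj f * adj g"
proof (rule poly_mapping_eqI)
  fix x
  have expand: "Poly_Mapping.lookup (p * q) y = (\<Sum>k\<in>Poly_Mapping.keys p.
      Poly_Mapping.lookup p k * Poly_Mapping.lookup q (y - k))" for p q :: "'a group_ring" and y
    by (subst (1) poly_mapping_sum_single [symmetric, of p])
       (simp add: sum_distrib_right lookup_sum lookup_single_times)
  have keys: "Poly_Mapping.keys (adj f) = uminus ` Poly_Mapping.keys f"
    by (force simp: in_keys_iff lookup_adj image_iff intro: bexI [of _ "- x" for x])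
  show "Poly_Mapping.lookup (adj (f * g)) x = Poly_Mapping.lookup (adj f * adj g) x"
    unfolding lookup_adj expand keys
    by (simp add: sum.reindex lookup_adj minus_diff_commute)
qed

section \<open>The l2 norm and Cauchy-Schwarz inequalities\<close>

definition l2norm :: "'a group_ring \<Rightarrow> real"
  where "l2norm f = L2_set (Poly_Mapping.lookup f) (Poly_Mapping.keys f)"

lemma l2norm_superset:
  assumes "finite S" "Poly_Mapping.keys f \<subseteq> S"
  shows "l2norm f = L2_set (Poly_Mapping.lookup f) S"
  unfolding l2norm_def L2_set_def
  using assms by (intro arg_cong [where f = sqrt] sum.mono_neutral_left) (auto simp: in_keys_iff)

lemma l2norm_nonneg [simp]: "0 \<le> l2norm f"
  by (simp add: l2norm_def)

lemma l2norm_add: "l2norm (f + g) \<le> l2norm f + l2norm g"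
proof -
  let ?S = "Poly_Mapping.keys f \<union> Poly_Mapping.keys g"
  have "l2norm (f + g) = L2_set (\<lambda>x. Poly_Mapping.lookup f x + Poly_Mapping.lookup g x) ?S"
    by (subst l2norm_superset [of ?S]) (auto simp: keys_add lookup_add [abs_def])
  also have "\<dots> \<le> L2_set (Poly_Mapping.lookup f) ?S + L2_set (Poly_Mapping.lookup g) ?S"
    by (rule L2_set_triangle_ineq)
  also have "\<dots> = l2norm f + l2norm g"
    by (simp add: l2norm_superset [of ?S])
  finally show ?thesis .
qed

lemma l2norm_zero [simp]: "l2norm 0 = 0"
  by (simp add: l2norm_def)

lemma l2norm_sum: "l2norm (\<Sum>i\<in>I. f i) \<le> (\<Sum>i\<in>I. l2norm (f i))"
proof (induction I rule: infinite_finite_induct)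
  case (insert i I)
  then show ?case
    using l2norm_add [of "f i" "\<Sum>i\<in>I. f i"] by simp
qed auto

lemma inner_expand:
  assumes "finite S" "Poly_Mapping.keys f \<subseteq> S"
  shows "Poly_Mapping.lookup (f * adj g) 0
    = (\<Sum>x\<in>S. Poly_Mapping.lookup f x * Poly_Mapping.lookup g x)"
proof -
  have "Poly_Mapping.lookup (f * adj g) 0
      = (\<Sum>x\<in>Poly_Mapping.keys f. Poly_Mapping.lookup f x * Poly_Mapping.lookup g x)"
    by (subst (1) poly_mapping_sum_single [symmetric, of f])
       (simp add: sum_distrib_right lookup_sum lookup_single_times lookup_adj)
  also have "\<dots> = (\<Sum>x\<in>S. Poly_Mapping.lookup f x * Poly_Mapping.lookup g x)"
    using assms by (intro sum.mono_neutral_left) (auto simp: in_keys_iff)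
  finally show ?thesis .
qed

lemma l2norm_power2: "(l2norm f)\<^sup>2 = Poly_Mapping.lookup (f * adj f) 0"
  by (simp add: inner_expand [OF _ subset_refl] l2norm_def L2_set_def sum_nonneg power2_eq_square)

lemma inner_le_l2norm:
  fixes f g :: "'a::ab_group_add group_ring"
  shows "Poly_Mapping.lookup (f * adj g) 0 \<le> l2norm f * l2norm g"
proof -
  let ?S = "Poly_Mapping.keys f \<union> Poly_Mapping.keys g"
  have "Poly_Mapping.lookup (f * adj g) 0
      \<le> (\<Sum>x\<in>?S. \<bar>Poly_Mapping.lookup f x\<bar> * \<bar>Poly_Mapping.lookup g x\<bar>)"
    by (subst inner_expand [of ?S]) (auto intro!: sum_mono simp flip: abs_mult)
  also have "\<dots> \<le> L2_set (Poly_Mapping.lookup f) ?S * L2_set (Poly_Mapping.lookup g) ?S"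
    by (rule L2_set_mult_ineq)
  also have "\<dots> = l2norm f * l2norm g"
    by (simp add: l2norm_superset [of ?S])
  finally show ?thesis .
qed

text \<open>By \<open>l2norm_power2\<close> the norm depends on \<open>f\<close> only through
  \<open>f * adj f\<close>. As the ring is commutative, a factor can therefore be exchanged for its
  adjoint without changing the norm.\<close>

lemma l2norm_eqI: "f * adj f = g * adj g \<Longrightarrow> l2norm f = l2norm g"
  by (metis l2norm_power2 l2norm_nonneg power2_eq_iff_nonneg)

text \<open>The product \<open>f * g * adj f * adj g\<close> regroups into the self-adjoint factors
  \<open>f * adj f\<close> and \<open>g * adj g\<close>, and Cauchy-Schwarz applies to their inner
  product.\<close>

lemma l2norm_mult_power2_le:
  fixes f g :: "'a::ab_group_add group_ring"
  shows "(l2norm (f * g))\<^sup>2 \<le> l2norm (f\<^sup>2) * l2norm (g\<^sup>2)"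
proof -
  have norm_adj: "l2norm (h * adj h) = l2norm (h\<^sup>2)" for h :: "'a group_ring"
    by (rule l2norm_eqI) (simp add: adj_mult power2_eq_square ac_simps)
  have "(l2norm (f * g))\<^sup>2 = Poly_Mapping.lookup ((f * adj f) * adj (g * adj g)) 0"
    by (simp add: l2norm_power2 adj_mult ac_simps)
  also have "\<dots> \<le> l2norm (f * adj f) * l2norm (g * adj g)"
    by (rule inner_le_l2norm)
  finally show ?thesis
    by (simp add: norm_adj)
qed

text \<open>The same fourfold product, now read as the inner product of \<open>f * adj f * g\<close>
  with \<open>g\<close>.\<close>

lemma l2norm_mult_le_square:
  fixes f g :: "'a::ab_group_add group_ring"
  shows "(l2norm (f * g))\<^sup>2 \<le> l2norm (f\<^sup>2 * g) * l2norm g"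
proof -
  have "(l2norm (f * g))\<^sup>2 = Poly_Mapping.lookup ((f * adj f * g) * adj g) 0"
    by (simp add: l2norm_power2 adj_mult ac_simps)
  also have "\<dots> \<le> l2norm (f * adj f * g) * l2norm g"
    by (rule inner_le_l2norm)
  also have "l2norm (f * adj f * g) = l2norm (f\<^sup>2 * g)"
    by (rule l2norm_eqI) (simp add: adj_mult power2_eq_square ac_simps)
  finally show ?thesis .
qed

text \<open>Squaring the bound and applying \<open>l2norm_mult_le_square\<close> doubles the
  exponent of \<open>f\<close> in each round, at the cost of further factors
  \<open>l2norm g\<close>. Hence the exponents are powers of two.\<close>

lemma l2norm_mult_power:
  fixes f g :: "'a::ab_group_add group_ring"
  shows "l2norm (f * g) ^ (2 ^ r) \<le> l2norm (f ^ (2 ^ r) * g) * l2norm g ^ (2 ^ r - 1)"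
proof (induction r)
  case (Suc r)
  let ?k = "2 ^ r :: nat"
  have "l2norm (f * g) ^ (2 ^ Suc r) = (l2norm (f * g) ^ ?k)\<^sup>2"
    by (simp add: power_mult [symmetric] mult.commute)
  also have "\<dots> \<le> (l2norm (f ^ ?k * g) * l2norm g ^ (?k - 1))\<^sup>2"
    by (intro power_mono Suc.IH) auto
  also have "\<dots> = (l2norm (f ^ ?k * g))\<^sup>2 * l2norm g ^ (2 * (?k - 1))"
    by (simp add: power_mult_distrib power_mult [symmetric] mult.commute)
  also have "\<dots> \<le> (l2norm ((f ^ ?k)\<^sup>2 * g) * l2norm g) * l2norm g ^ (2 * (?k - 1))"
    by (intro mult_right_mono l2norm_mult_le_square) auto
  also have "\<dots> = l2norm (f ^ (2 ^ Suc r) * g) * l2norm g ^ Suc (2 * (?k - 1))"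
    by (simp add: power_mult [symmetric] mult.commute)
  also have "Suc (2 * (?k - 1)) = 2 ^ Suc r - 1"
    using one_le_power [of "2::nat" r] by (simp only: power_Suc) linarith
  finally show ?case .
qed simp

text \<open>\<open>Poly_Mapping.single x 1\<close> is inverse to its adjoint, so translation is an
  isometry.\<close>

lemma l2norm_single_times [simp]:
  fixes f :: "'a::ab_group_add group_ring"
  shows "l2norm (Poly_Mapping.single x 1 * f) = l2norm f"
proof (rule l2norm_eqI)
  have "Poly_Mapping.single x 1 * f * adj (Poly_Mapping.single x 1 * f)
      = (Poly_Mapping.single x 1 * Poly_Mapping.single (- x) 1) * (f * adj f)"
    by (simp add: adj_mult ac_simps)
  then show "Poly_Mapping.single x 1 * f * adj (Poly_Mapping.single x 1 * f) = f * adj f"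
    by (simp add: mult_single)
qed

section \<open>Indicators and additive energy\<close>

definition ind :: "'a set \<Rightarrow> 'a group_ring"
  where "ind S = (\<Sum>x\<in>S. Poly_Mapping.single x 1)"

lemma l2norm_ind_times:
  fixes f :: "'a::ab_group_add group_ring"
  shows "l2norm (ind S * f) \<le> card S * l2norm f"
  using l2norm_sum [of "\<lambda>x. Poly_Mapping.single x 1 * f" S]
  by (simp add: ind_def sum_distrib_right)

text \<open>The coefficient at \<open>y\<close> is the size of the fibre of \<open>f\<close> over
  \<open>y\<close>, so the squared norm counts collisions. Summing over indices keeps the
  multiplicity of repeated values.\<close>

lemma l2norm_sum_single:
  fixes f :: "'i \<Rightarrow> 'a::ab_group_add"
  assumes "finite I"
  shows "(l2norm (\<Sum>i\<in>I. Poly_Mapping.single (f i) 1))\<^sup>2 = card {(i, j). i \<in> I \<and> j \<in> I \<and> f i = f j}"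
proof -
  have "(l2norm (\<Sum>i\<in>I. Poly_Mapping.single (f i) 1))\<^sup>2
      = (\<Sum>i\<in>I. \<Sum>j\<in>I. if f i = f j then 1 else 0)"
    by (simp add: l2norm_power2 adj_sum sum_product mult_single lookup_sum lookup_single when_def)
  also have "\<dots> = (\<Sum>(i, j)\<in>I \<times> I. if f i = f j then 1 else 0)"
    by (rule sum.cartesian_product)
  also have "\<dots> = (\<Sum>p\<in>{(i, j). i \<in> I \<and> j \<in> I \<and> f i = f j}. 1)"
    using assms by (intro sum.mono_neutral_cong_right) (auto split: if_splits)
  finally show ?thesis
    by simp
qed

lemma l2norm_sum_single_inj:
  fixes f :: "'i \<Rightarrow> 'a::ab_group_add"
  assumes "finite I" "inj_on f I"
  shows "(l2norm (\<Sum>i\<in>I. Poly_Mapping.single (f i) 1))\<^sup>2 = card I"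
proof -
  have "{(i, j). i \<in> I \<and> j \<in> I \<and> f i = f j} = (\<lambda>i. (i, i)) ` I"
    using assms(2) by (auto dest: inj_onD)
  then show ?thesis
    by (simp add: l2norm_sum_single [OF assms(1)] card_image inj_on_def)
qed

lemma l2norm_ind:
  fixes S :: "'a::ab_group_add set"
  assumes "finite S"
  shows "l2norm (ind S) = sqrt (card S)"
  using l2norm_sum_single_inj [OF assms, of "\<lambda>x. x"]
  by (simp add: ind_def real_sqrt_unique)

lemma l2norm_ind_square:
  fixes A :: "'a::ab_group_add set"
  assumes "finite A"
  shows "(l2norm (ind A ^ 2))\<^sup>2 = card {(a, b, c, d). a \<in> A \<and> b \<in> A \<and> c \<in> A \<and> d \<in> A \<and> a + b = c + d}"
    (is "_ = real (card ?Q)")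
proof -
  have "ind A ^ 2 = (\<Sum>p\<in>A \<times> A. Poly_Mapping.single (fst p + snd p) 1)"
    by (simp add: power2_eq_square ind_def sum_product mult_single sum.cartesian_product split_def)
  then have "(l2norm (ind A ^ 2))\<^sup>2
      = card {(p, q). p \<in> A \<times> A \<and> q \<in> A \<times> A \<and> fst p + snd p = fst q + snd q}"
    using assms by (simp only: l2norm_sum_single finite_cartesian_product)
  also have "{(p, q). p \<in> A \<times> A \<and> q \<in> A \<times> A \<and> fst p + snd p = fst q + snd q}
      = (\<lambda>(a, b, c, d). ((a, b), (c, d))) ` ?Q"
    by (auto simp: image_iff)
  also have "card \<dots> = card ?Q"
    by (rule card_image) (auto simp: inj_on_def)
  finally show ?thesis .
qed

subsection \<open>Dissociated sets\<close>

text \<open>For finite \<open>L\<close> this is equivalent to the absence of a nontrivial relation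
  with coefficients in {-1, 0, 1}, which is what ties it to \<open>Span\<close>.\<close>

definition dissociated :: "'a::ab_group_add set \<Rightarrow> bool"
  where "dissociated L \<longleftrightarrow> inj_on (\<lambda>S. \<Sum>S) (Pow L)"

lemma dissociated_subset: "dissociated L \<Longrightarrow> M \<subseteq> L \<Longrightarrow> dissociated M"
  unfolding dissociated_def by (erule inj_on_subset) auto

section \<open>Elementary symmetric sums\<close>

text \<open>The elementary symmetric polynomial of degree \<open>s\<close> evaluated at the group
  elements in \<open>L\<close>, viewed in the group ring.\<close>

definition esym :: "nat \<Rightarrow> 'a::ab_group_add set \<Rightarrow> 'a group_ring"
  where "esym s L = (\<Sum>S | S \<subseteq> L \<and> card S = s. Poly_Mapping.single (\<Sum>S) 1)"

text \<open>Distinct subset sums make the squared norm equal to the number of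
  \<open>s\<close>-subsets. The parameter \<open>n\<close> lets all subsets of one fixed set share
  the same bound.\<close>

lemma l2norm_esym_le:
  assumes "finite L" "dissociated L" "card L \<le> n"
  shows "l2norm (esym s L) \<le> sqrt (n ^ s / fact s)"
proof -
  have "inj_on (\<lambda>S. \<Sum>S) {S. S \<subseteq> L \<and> card S = s}"
    using assms(2) unfolding dissociated_def by (rule inj_on_subset) auto
  then have "(l2norm (esym s L))\<^sup>2 = card L choose s"
    unfolding esym_def using assms(1)
    by (subst l2norm_sum_single_inj) (auto simp: n_subsets)
  also have "\<dots> \<le> n ^ s / fact s"
  proof -
    have "(card L choose s) * fact s \<le> card L ^ s"
      by (rule binomial_fact_pow)
    also have "\<dots> \<le> n ^ s"
      using assms(3) by (rule power_mono) simp
    finally have "real (card L choose s) * fact s \<le> real n ^ s"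
      by (metis of_nat_fact of_nat_le_iff of_nat_mult of_nat_power)
    then show ?thesis
      by (simp add: field_simps)
  qed
  finally show ?thesis
    by (simp add: real_le_rsqrt)
qed

lemma esym_0 [simp]: "finite L \<Longrightarrow> esym 0 L = 1"
proof -
  assume "finite L"
  then have "{S. S \<subseteq> L \<and> card S = 0} = {{}}"
    by (auto dest: finite_subset)
  then show ?thesis
    by (simp add: esym_def)
qed

lemma esym_Suc_remove:
  assumes "finite L" "x \<in> L"
  shows "esym (Suc s) L = esym (Suc s) (L - {x}) + Poly_Mapping.single x 1 * esym s (L - {x})"
proof -
  let ?P = "{S. S \<subseteq> L - {x} \<and> card S = Suc s}" and ?Q = "{S. S \<subseteq> L - {x} \<and> card S = s}"
  have fin: "finite S" if "S \<subseteq> L" for S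
    using assms(1) that by (rule rev_finite_subset)
  have inj: "inj_on (insert x) ?Q"
    by (auto simp: inj_on_def)
  have "{S. S \<subseteq> L \<and> card S = Suc s} = ?P \<union> insert x ` ?Q"
  proof (intro equalityI subsetI)
    fix S assume S: "S \<in> {S. S \<subseteq> L \<and> card S = Suc s}"
    show "S \<in> ?P \<union> insert x ` ?Q"
    proof (cases "x \<in> S")
      case True
      then have "S = insert x (S - {x})" "S - {x} \<in> ?Q"
        using S fin [of S] by auto
      then show ?thesis by blast
    qed (use S in auto)
  next
    fix S assume "S \<in> ?P \<union> insert x ` ?Q"
    moreover have "card (insert x T) = Suc s" if "T \<in> ?Q" for T
      using that fin [of T] by (subst card_insert_disjoint) auto
    ultimately show "S \<in> {S. S \<subseteq> L \<and> card S = Suc s}"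
      using assms(2) by auto
  qed
  then have "esym (Suc s) L = (\<Sum>S\<in>?P. Poly_Mapping.single (\<Sum>S) 1)
      + (\<Sum>S\<in>insert x ` ?Q. Poly_Mapping.single (\<Sum>S) 1)"
    unfolding esym_def using assms(1) by (simp only:) (rule sum.union_disjoint, auto)
  also have "(\<Sum>S\<in>insert x ` ?Q. Poly_Mapping.single (\<Sum>S) 1)
      = Poly_Mapping.single x 1 * (esym s (L - {x}) :: 'a group_ring)"
    unfolding esym_def sum_distrib_left sum.reindex [OF inj]
  proof (rule sum.cong)
    fix S assume "S \<in> ?Q"
    then have "finite S" "x \<notin> S"
      using fin [of S] by auto
    then show "((\<lambda>S. Poly_Mapping.single (\<Sum>S) 1) \<circ> insert x) S
        = Poly_Mapping.single x 1 * (Poly_Mapping.single (\<Sum>S) 1 :: 'a group_ring)"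
      by (simp add: mult_single)
  qed simp
  finally show ?thesis
    by (simp add: esym_def)
qed

text \<open>Double counting: each set \<open>T\<close> of size \<open>Suc s\<close> arises from the
  pairs \<open>(x, T - {x})\<close>, once for every \<open>x\<close> in \<open>T\<close>.\<close>

lemma sum_single_times_esym_remove:
  assumes "finite L"
  shows "(\<Sum>x\<in>L. Poly_Mapping.single x 1 * esym s (L - {x})) = of_nat (Suc s) * esym (Suc s) L"
proof -
  have fin: "finite S" if "S \<subseteq> L" for S
    using assms that by (rule rev_finite_subset)
  have "(\<Sum>x\<in>L. Poly_Mapping.single x 1 * esym s (L - {x}))
      = (\<Sum>x\<in>L. \<Sum>S | S \<subseteq> L - {x} \<and> card S = s. Poly_Mapping.single (x + \<Sum>S) (1::real))"
    by (simp add: esym_def sum_distrib_left mult_single)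
  also have "\<dots> = (\<Sum>(x, S)\<in>(SIGMA x:L. {S. S \<subseteq> L - {x} \<and> card S = s}). Poly_Mapping.single (x + \<Sum>S) 1)"
    using assms by (subst sum.Sigma) auto
  also have "\<dots> = (\<Sum>(T, x)\<in>(SIGMA T:{T. T \<subseteq> L \<and> card T = Suc s}. T). Poly_Mapping.single (\<Sum>T) 1)"
  proof (rule sum.reindex_bij_witness [where i = "\<lambda>(T, x). (x, T - {x})" and j = "\<lambda>(x, S). (insert x S, x)"], goal_cases)
    case (2 p)
    then obtain x S where p: "p = (x, S)" "x \<in> L" "S \<subseteq> L - {x}" "card S = s" by auto
    then have "finite S" "x \<notin> S" using fin [of S] by auto
    with p show ?case by auto
  next
    case (4 p)
    then show ?case using fin [of "fst p"] by (auto simp: card_Diff_singleton)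
  next
    case (5 p)
    then obtain x S where p: "p = (x, S)" "x \<in> L" "S \<subseteq> L - {x}" "card S = s" by auto
    then have "finite S" "x \<notin> S" using fin [of S] by auto
    with p show ?case by auto
  qed auto
  also have "\<dots> = (\<Sum>T | T \<subseteq> L \<and> card T = Suc s. \<Sum>x\<in>T. Poly_Mapping.single (\<Sum>T) 1)"
    using assms fin by (subst sum.Sigma) auto
  also have "\<dots> = of_nat (Suc s) * esym (Suc s) L"
    unfolding esym_def sum_distrib_left by (intro sum.cong) auto
  finally show ?thesis .
qed

text \<open>A Newton-type identity. For each \<open>x\<close>, the subsets avoiding \<open>x\<close>
  are enlarged by it, which \<open>sum_single_times_esym_remove\<close> counts; the subsets
  containing \<open>x\<close> acquire it twice.\<close>

lemma ind_times_esym_Suc: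
  assumes "finite L"
  shows "ind L * esym (Suc s) L = of_nat (Suc (Suc s)) * esym (Suc (Suc s)) L
    + (\<Sum>x\<in>L. Poly_Mapping.single (x + x) 1 * esym s (L - {x}))"
proof -
  have "ind L * esym (Suc s) L = (\<Sum>x\<in>L. Poly_Mapping.single x 1 *
      (esym (Suc s) (L - {x}) + Poly_Mapping.single x 1 * esym s (L - {x})))"
    unfolding ind_def sum_distrib_right
    by (intro sum.cong refl) (metis esym_Suc_remove assms)
  also have "\<dots> = (\<Sum>x\<in>L. Poly_Mapping.single x 1 * esym (Suc s) (L - {x}))
      + (\<Sum>x\<in>L. Poly_Mapping.single (x + x) 1 * esym s (L - {x}))"
    by (simp add: distrib_left sum.distrib mult_single flip: mult.assoc)
  finally show ?thesis
    by (simp only: sum_single_times_esym_remove [OF assms])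
qed

lemma ind_times_esym_0:
  assumes "finite L"
  shows "ind L * esym 0 L = esym 1 L"
  using sum_single_times_esym_remove [OF assms, of 0] assms
  by (simp add: ind_def)

section \<open>A combinatorial Rudin inequality\<close>

lemma l2norm_of_nat_times: "l2norm (of_nat m * f) \<le> m * l2norm f"
proof -
  have "of_nat m * f = (\<Sum>i<m. f)" by simp
  then show ?thesis using l2norm_sum [of "\<lambda>_. f" "{..<m}"] by (simp del: sum_constant) simp
qed

text \<open>
  Multiplying \<open>esym s M\<close> by the indicator of \<open>L\<close> produces \<open>esym (s + 1) M\<close>, translates of
  \<open>esym (s - 1) (M - {x})\<close> and translates of \<open>esym s M\<close>. The sum in the second
  assumption does not increase under any of the three, and relative to the weights
  \<open>sqrt (card L ^ s / fact s)\<close> each contributes a factor of at most \<open>sqrt (k * card L)\<close>.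
\<close>

lemma l2norm_dissociated_power_times_esym:
  fixes L :: "'a::ab_group_add set"
  assumes L: "finite L" "dissociated L" and k: "k \<le> card L"
  assumes "M \<subseteq> L" "card (L - M) + s + j \<le> k"
  shows "l2norm (ind L ^ j * esym s M) \<le> (3 * sqrt (k * card L)) ^ j * sqrt (card L ^ s / fact s)"
  using assms(4,5)
proof (induction j arbitrary: s M)
  case 0
  have "finite M" "dissociated M" "card M \<le> card L"
    using 0 L by (auto intro: finite_subset dissociated_subset card_mono)
  then show ?case
    by (simp add: l2norm_esym_le)
next
  case (Suc j)
  define n where "n = card L"
  define q where "q = sqrt (real (k * n))"
  define W where "W s = sqrt (real n ^ s / fact s)" for s
  define c where "c = (3 * q) ^ j"
  have IH: "l2norm (ind L ^ j * esym t N) \<le> c * W t"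
    if "N \<subseteq> L" "card (L - N) + t + j \<le> k" for t N
    using Suc.IH [OF that] by (simp add: c_def q_def W_def n_def)
  have fin: "finite M"
    using Suc.prems L finite_subset by blast
  have W_Suc: "W (Suc t) = sqrt n / sqrt (Suc t) * W t" for t
    by (simp add: W_def real_sqrt_mult real_sqrt_divide del: of_nat_Suc)
  have W_nonneg: "0 \<le> W t" for t
    by (simp add: W_def)
  have c_nonneg: "0 \<le> c"
    by (simp add: c_def q_def)
  have q_ge: "sqrt t * sqrt n \<le> q" if "t \<le> k" for t :: nat
    using that by (simp add: q_def real_sqrt_mult mult_right_mono)
  let ?D = "\<lambda>x. Poly_Mapping.single (x + x) 1 :: 'a group_ring"
  \<comment> \<open>The case distinction is essential: \<open>s - 1\<close> is 0 for
    \<open>s = 0\<close>, but the term must then vanish, as the empty set has no element to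
    repeat.\<close>
  let ?two = "\<Sum>x\<in>M. if s = 0 then 0 else ?D x * esym (s - 1) (M - {x})"
  \<comment> \<open>Elements of \<open>M\<close> are handled by the Newton-type identities, elements
    of \<open>L - M\<close> merely translate.\<close>
  have split: "ind L * esym s M = of_nat (Suc s) * esym (Suc s) M + ?two
      + (\<Sum>x\<in>L - M. Poly_Mapping.single x 1 * esym s M)"
  proof -
    have "ind L = ind M + ind (L - M)"
      using Suc.prems L unfolding ind_def by (metis add.commute sum.subset_diff)
    moreover have "ind M * esym s M = of_nat (Suc s) * esym (Suc s) M + ?two"
      using ind_times_esym_0 [OF fin] ind_times_esym_Suc [OF fin] by (cases s) auto
    ultimately show ?thesis
      by (simp add: distrib_right ind_def sum_distrib_right)
  qed
  \<comment> \<open>Passing from \<open>W (Suc s)\<close> to \<open>W s\<close> turns the factor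
    \<open>Suc s\<close> into \<open>sqrt (Suc s) * sqrt n\<close>, and \<open>Suc s\<close> is at
    most \<open>k\<close>.\<close>
  have 1: "l2norm (ind L ^ j * (of_nat (Suc s) * esym (Suc s) M)) \<le> q * (c * W s)"
  proof -
    have "l2norm (ind L ^ j * (of_nat (Suc s) * esym (Suc s) M))
        \<le> Suc s * l2norm (ind L ^ j * esym (Suc s) M)"
      using l2norm_of_nat_times [of "Suc s" "ind L ^ j * esym (Suc s) M"]
      by (simp only: mult.left_commute)
    also have "\<dots> \<le> Suc s * (c * W (Suc s))"
      using Suc.prems by (intro mult_left_mono IH) auto
    also have "\<dots> = (real (Suc s) / sqrt (Suc s)) * sqrt n * (c * W s)"
      by (simp only: W_Suc) (simp add: field_simps del: of_nat_Suc)
    also have "\<dots> = sqrt (Suc s) * sqrt n * (c * W s)"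
      by (simp only: real_div_sqrt [OF of_nat_0_le_iff])
    also have "\<dots> \<le> q * (c * W s)"
      using Suc.prems c_nonneg W_nonneg by (intro mult_right_mono q_ge) auto
    finally show ?thesis .
  qed
  \<comment> \<open>There are at most \<open>n\<close> translates, but the weight drops to
    \<open>W (s - 1)\<close>; together this gives \<open>sqrt s * sqrt n\<close>. Removing
    \<open>x\<close> from \<open>M\<close> is paid for by the decrease of \<open>s\<close>.\<close>
  have 2: "l2norm (ind L ^ j * ?two) \<le> q * (c * W s)"
  proof (cases s)
    case 0
    then show ?thesis
      using c_nonneg W_nonneg by (simp add: q_def)
  next
    case (Suc t)
    have bound: "l2norm (ind L ^ j * (?D x * esym t (M - {x}))) \<le> c * W t" if "x \<in> M" for x
    proof -
      have "L - (M - {x}) = insert x (L - M)"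
        using that Suc.prems by auto
      then have "card (L - (M - {x})) = Suc (card (L - M))"
        using that L by simp
      then have "l2norm (ind L ^ j * esym t (M - {x})) \<le> c * W t"
        using Suc.prems Suc by (intro IH) auto
      then show ?thesis
        by (simp add: mult.left_commute [of _ "?D x"])
    qed
    have "l2norm (ind L ^ j * ?two) \<le> (\<Sum>x\<in>M. l2norm (ind L ^ j * (?D x * esym t (M - {x}))))"
      using l2norm_sum [of "\<lambda>x. ind L ^ j * (?D x * esym t (M - {x}))" M] Suc
      by (simp add: sum_distrib_left)
    also have "\<dots> \<le> card M * (c * W t)"
      by (rule sum_bounded_above) (rule bound)
    also have "\<dots> \<le> n * (c * W t)"
      using Suc.prems L c_nonneg W_nonneg by (intro mult_right_mono) (auto simp: n_def intro: card_mono)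
    also have "\<dots> = sqrt s * sqrt n * (c * W s)"
    proof -
      have "sqrt n * sqrt n = n" by simp
      then show ?thesis
        by (simp add: Suc W_Suc field_simps del: of_nat_Suc real_sqrt_mult_self)
    qed
    also have "\<dots> \<le> q * (c * W s)"
      using Suc.prems c_nonneg W_nonneg by (intro mult_right_mono q_ge) auto
    finally show ?thesis .
  qed
  \<comment> \<open>The number of translates is at most both \<open>k\<close> and \<open>n\<close>,
    hence at most their geometric mean \<open>q\<close>.\<close>
  have 3: "l2norm (ind L ^ j * (\<Sum>x\<in>L - M. Poly_Mapping.single x 1 * esym s M)) \<le> q * (c * W s)"
  proof -
    have "l2norm (ind L ^ j * (\<Sum>x\<in>L - M. Poly_Mapping.single x 1 * esym s M))
        \<le> (\<Sum>x\<in>L - M. l2norm (ind L ^ j * esym s M))"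
      using l2norm_sum [of "\<lambda>x. Poly_Mapping.single x 1 * (ind L ^ j * esym s M)" "L - M"]
      by (simp add: sum_distrib_left mult.left_commute [of _ "Poly_Mapping.single _ _"] del: sum_constant)
    also have "\<dots> \<le> card (L - M) * (c * W s)"
      using Suc.prems by (intro sum_bounded_above IH) auto
    also have "\<dots> \<le> q * (c * W s)"
    proof (intro mult_right_mono)
      have "real (card (L - M)) = sqrt (real (card (L - M)) * card (L - M))"
        by simp
      also have "\<dots> \<le> q"
        unfolding q_def of_nat_mult using Suc.prems k
        by (intro real_sqrt_le_mono mult_mono) (auto simp: n_def)
      finally show "real (card (L - M)) \<le> q" .
    qed (use c_nonneg W_nonneg in auto)
    finally show ?thesis .
  qed
  have "l2norm (ind L ^ Suc j * esym s M) = l2norm (ind L ^ j * (ind L * esym s M))"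
    by (simp add: mult.left_commute mult.assoc)
  also have "\<dots> \<le> q * (c * W s) + q * (c * W s) + q * (c * W s)"
    unfolding split distrib_left
    by (intro order_trans [OF l2norm_add] add_mono 1 2 3)
  also have "\<dots> = (3 * q) ^ Suc j * W s"
    by (simp add: c_def)
  finally show ?case
    by (simp add: q_def W_def n_def)
qed

text \<open>The case \<open>M = L\<close>, \<open>s = 0\<close>, where \<open>esym\<close> is 1.
  Squared, it says that x_1 + ... + x_k = y_1 + ... + y_k has at most (9 k |L|)^k solutions in
  \<open>L\<close>.\<close>

lemma l2norm_dissociated_power:
  assumes "finite L" "dissociated L" "k \<le> card L"
  shows "l2norm (ind L ^ k) \<le> (3 * sqrt (k * card L)) ^ k"
  using l2norm_dissociated_power_times_esym [OF assms, of L 0 k] assms by simp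

text \<open>Iterated Cauchy-Schwarz reduces the claim to the bound on \<open>ind L ^ k\<close>.
  Compared with the desired \<open>k\<close>-th power, one factor \<open>sqrt (card A)\<close> is
  left over; it is at most \<open>sqrt 2 ^ k\<close>, so it costs only \<open>sqrt 2\<close> after
  taking \<open>k\<close>-th roots.\<close>

lemma l2norm_dissociated_times:
  assumes L: "finite L" "dissociated L" and A: "finite A" "card A \<le> 2 ^ k"
    and k: "k = 2 ^ r" "k \<le> card L"
  shows "l2norm (ind L * ind A) \<le> 3 * sqrt (2 * k * card L * card A)"
proof -
  let ?a = "sqrt (card A)"
  have "0 < k" using k by simp
  have "l2norm (ind L * ind A) ^ k \<le> l2norm (ind L ^ k * ind A) * l2norm (ind A) ^ (k - 1)"
    using l2norm_mult_power [of "ind L" "ind A" r] k by simp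
  also have "\<dots> \<le> (card A * (3 * sqrt (k * card L)) ^ k) * l2norm (ind A) ^ (k - 1)"
  proof (rule mult_right_mono)
    have "l2norm (ind L ^ k * ind A) \<le> card A * l2norm (ind L ^ k)"
      using l2norm_ind_times [of A "ind L ^ k"] by (simp add: mult.commute)
    also have "\<dots> \<le> card A * (3 * sqrt (k * card L)) ^ k"
      using L k by (intro mult_left_mono l2norm_dissociated_power) auto
    finally show "l2norm (ind L ^ k * ind A) \<le> card A * (3 * sqrt (k * card L)) ^ k" .
  qed simp
  also have "\<dots> = (3 * sqrt (k * card L)) ^ k * ?a * (?a * ?a ^ (k - 1))"
    using A by (simp add: l2norm_ind)
  also have "?a * ?a ^ (k - 1) = ?a ^ k"
    using \<open>0 < k\<close> by (simp add: power_eq_if)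
  also have "(3 * sqrt (k * card L)) ^ k * ?a * ?a ^ k \<le> (3 * sqrt (k * card L)) ^ k * sqrt 2 ^ k * ?a ^ k"
  proof -
    have "real (card A) \<le> 2 ^ k"
      using A by (metis of_nat_le_iff of_nat_numeral of_nat_power)
    then have "?a \<le> sqrt 2 ^ k"
      by (metis real_sqrt_le_mono real_sqrt_power)
    then show ?thesis
      by (intro mult_right_mono mult_left_mono) auto
  qed
  also have "\<dots> = (3 * sqrt (2 * k * card L * card A)) ^ k"
    by (simp add: real_sqrt_mult ac_simps flip: power_mult_distrib)
  finally show ?thesis
    using \<open>0 < k\<close> by (subst (asm) power_mono_iff) auto
qed

subsection \<open>Sets of large energy\<close>

text \<open>Greedy removal: as long as a dissociated set of size \<open>l\<close> remains, it is
  split off, adding at most \<open>c\<close> to the norm. The factor \<open>l\<close> on the left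
  replaces the number \<open>card (A - B) / l\<close> of removed blocks.\<close>

lemma exists_dissociated_free_subset:
  fixes f :: "'a::ab_group_add group_ring" and c :: real
  assumes "finite A" "0 < l"
    and "\<And>L. L \<subseteq> A \<Longrightarrow> dissociated L \<Longrightarrow> card L = l \<Longrightarrow> l2norm (ind L * f) \<le> c"
  shows "\<exists>B\<subseteq>A. (\<forall>L\<subseteq>B. dissociated L \<longrightarrow> card L \<noteq> l)
    \<and> l * l2norm (ind (A - B) * f) \<le> card (A - B) * c"
  using assms(1,3)
proof (induction A rule: finite_psubset_induct)
  case (psubset A)
  show ?case
  proof (cases "\<exists>L\<subseteq>A. dissociated L \<and> card L = l")
    case False
    then show ?thesis
      by (intro exI [of _ A]) (auto simp: ind_def)
  next
    case True
    then obtain L where L: "L \<subseteq> A" "dissociated L" "card L = l"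
      by blast
    have "finite L"
      using L psubset.hyps finite_subset by blast
    have "L \<noteq> {}"
      using L \<open>0 < l\<close> by auto
    then have "A - L \<subset> A"
      using L by blast
    then have "\<exists>B\<subseteq>A - L. (\<forall>M\<subseteq>B. dissociated M \<longrightarrow> card M \<noteq> l)
        \<and> l * l2norm (ind (A - L - B) * f) \<le> card (A - L - B) * c"
      by (rule psubset.IH) (rule psubset.prems, auto)
    then obtain B where B: "B \<subseteq> A - L" "\<forall>M\<subseteq>B. dissociated M \<longrightarrow> card M \<noteq> l"
      "l * l2norm (ind (A - L - B) * f) \<le> card (A - L - B) * c"
      by blast
    have eq: "A - B = (A - L - B) \<union> L" and disj: "(A - L - B) \<inter> L = {}"
      using B L by auto
    have "ind (A - B) = ind (A - L - B) + ind L"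
      unfolding eq ind_def using psubset.hyps \<open>finite L\<close> disj by (intro sum.union_disjoint) auto
    then have "l * l2norm (ind (A - B) * f) \<le> l * (l2norm (ind (A - L - B) * f) + l2norm (ind L * f))"
      by (intro mult_left_mono) (simp_all add: distrib_right l2norm_add)
    also have "\<dots> \<le> card (A - L - B) * c + l * c"
      using B(3) psubset.prems [OF L] by (simp add: distrib_left add_mono mult_left_mono)
    also have "\<dots> = card (A - B) * c"
      unfolding eq using psubset.hyps \<open>finite L\<close> disj L
      by (subst card_Un_disjoint) (auto simp: distrib_right)
    finally show ?thesis
      using B by blast
  qed
qed

section \<open>Spans and maximal dissociated subsets\<close>

lemma diff_subset_sums_in_Span:
  assumes "finite L" "S \<subseteq> L" "T \<subseteq> L"
  shows "\<Sum>S - \<Sum>T \<in> Span L"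
proof -
  \<comment> \<open>Elements common to \<open>S\<close> and \<open>T\<close> cancel, so the
    coefficients stay in {-1, 0, 1}.\<close>
  define c :: "'a \<Rightarrow> int" where "c x = of_bool (x \<in> S) - of_bool (x \<in> T)" for x
  have "int_mult (c x) x = (if x \<in> S then x else 0) - (if x \<in> T then x else 0)" for x
    by (auto simp: c_def int_mult_def)
  then have "(\<Sum>x\<in>L. int_mult (c x) x) = \<Sum>(L \<inter> S) - \<Sum>(L \<inter> T)"
    using assms(1) by (simp add: sum_subtractf sum.inter_restrict)
  then have "\<Sum>S - \<Sum>T = (\<Sum>x\<in>L. int_mult (c x) x)"
    using assms(2,3) by (simp add: Int_absorb1)
  moreover have "\<forall>x\<in>L. c x \<in> {-1, 0, 1}"
    by (auto simp: c_def)
  ultimately show ?thesis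
    unfolding Span_def by blast
qed

text \<open>Two different subsets of \<open>insert x L\<close> have equal sums. If \<open>x\<close>
  were in both or in neither, \<open>L\<close> would not be dissociated; otherwise the equation can
  be solved for \<open>x\<close>.\<close>

lemma in_Span_if_not_dissociated_insert:
  assumes L: "finite L" "dissociated L" and x: "x \<notin> L" "\<not> dissociated (insert x L)"
  shows "x \<in> Span L"
proof -
  have *: "x \<in> Span L" if S: "S \<subseteq> insert x L" and T: "T \<subseteq> L" and "x \<in> S" and "\<Sum>S = \<Sum>T" for S T
  proof -
    have "\<Sum>S = x + \<Sum>(S - {x})"
      using that L by (intro sum.remove) (auto intro: finite_subset)
    then have "x = \<Sum>T - \<Sum>(S - {x})"
      using \<open>\<Sum>S = \<Sum>T\<close> by (simp add: algebra_simps)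
    also have "\<dots> \<in> Span L"
      using S T L by (intro diff_subset_sums_in_Span) auto
    finally show ?thesis .
  qed
  obtain S T where ST: "S \<subseteq> insert x L" "T \<subseteq> insert x L" "\<Sum>S = \<Sum>T" "S \<noteq> T"
    using x(2) unfolding dissociated_def inj_on_def by auto
  have inj: "P = Q" if "P \<subseteq> L" "Q \<subseteq> L" "\<Sum>P = \<Sum>Q" for P Q
    using L(2) that unfolding dissociated_def by (auto dest: inj_onD)
  have fin: "finite S" "finite T"
    using ST L by (auto intro: finite_subset)
  consider "x \<in> S" "x \<in> T" | "x \<in> S" "x \<notin> T" | "x \<notin> S" "x \<in> T" | "x \<notin> S" "x \<notin> T"
    by blast
  then show ?thesis
  proof cases
    case 1
    then have "\<Sum>(S - {x}) = \<Sum>(T - {x})"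
      using ST(3) fin by (simp add: sum_diff1)
    then have "S - {x} = T - {x}"
      using ST by (intro inj) auto
    with 1 ST(4) show ?thesis by blast
  next
    case 2
    then show ?thesis using * [of S T] ST by blast
  next
    case 3
    then show ?thesis using * [of T S] ST by (metis subset_insert)
  next
    case 4
    then show ?thesis using inj [of S T] ST by blast
  qed
qed

text \<open>Take a maximal dissociated subset of \<open>B\<close>. Were it to have \<open>l\<close>
  or more elements, it would contain a dissociated set of size exactly \<open>l\<close>; by
  maximality it spans \<open>B\<close>.\<close>

lemma dissociated_free_subset_Span:
  fixes B :: "'a::ab_group_add set"
  assumes "finite B" and free: "\<forall>L\<subseteq>B. dissociated L \<longrightarrow> card L \<noteq> l"
  shows "\<exists>L. finite L \<and> card L < l \<and> B \<subseteq> Span L"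
proof -
  let ?D = "{L. L \<subseteq> B \<and> dissociated L}"
  have "finite ?D" "?D \<noteq> {}"
    using assms(1) by (auto simp: dissociated_def intro: exI [of _ "{}"])
  from finite_has_maximal [OF this] obtain L where "L \<in> ?D" "\<forall>M\<in>?D. L \<subseteq> M \<longrightarrow> L = M"
    by (elim bexE)
  then have L: "L \<subseteq> B" "dissociated L"
    and max: "\<And>M. M \<subseteq> B \<Longrightarrow> dissociated M \<Longrightarrow> L \<subseteq> M \<Longrightarrow> L = M"
    by simp_all
  have fin: "finite L"
    using L assms(1) finite_subset by blast
  have "card L < l"
  proof (rule ccontr)
    assume "\<not> card L < l"
    then obtain M where "M \<subseteq> L" "card M = l"
      by (metis not_less obtain_subset_with_card_n)
    then show False
      using free L dissociated_subset by blast
  qed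
  moreover have "x \<in> Span L" if "x \<in> B" for x
  proof (cases "x \<in> L")
    case True
    then show ?thesis
      using diff_subset_sums_in_Span [OF fin, of "{x}" "{}"] by simp
  next
    case False
    then have "\<not> dissociated (insert x L)"
      using max [of "insert x L"] L that by blast
    then show ?thesis
      using False fin L by (intro in_Span_if_not_dissociated_insert)
  qed
  ultimately show ?thesis
    using fin by blast
qed

section \<open>Energy estimates and conclusion\<close>

lemma energy_le_card_cube:
  fixes B :: "'a::ab_group_add set"
  assumes "finite B"
  shows "(l2norm (ind B ^ 2))\<^sup>2 \<le> card B ^ 3"
proof -
  have "(l2norm (ind B ^ 2))\<^sup>2 \<le> (card B * sqrt (card B))\<^sup>2"
    using l2norm_ind_times [of B "ind B"] assms
    by (intro power_mono) (simp_all add: l2norm_ind power2_eq_square)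
  also have "\<dots> = card B ^ 3"
    by (simp add: power_mult_distrib power3_eq_cube power2_eq_square)
  finally show ?thesis .
qed

text \<open>Supplies the exponent for iterated squaring: rounding up to a power of two costs at most
  a factor 2.\<close>

lemma exists_power_of_two_between:
  fixes x :: real
  assumes "1 \<le> x"
  shows "\<exists>r. x \<le> 2 ^ r \<and> 2 ^ r \<le> 2 * x"
proof -
  define r where "r = nat \<lceil>log 2 x\<rceil>"
  have "0 \<le> log 2 x"
    using assms by simp
  then have r: "log 2 x \<le> r" "r \<le> log 2 x + 1"
    unfolding r_def by linarith+
  have "x = 2 powr log 2 x"
    using assms by simp
  also have "\<dots> \<le> 2 powr r"
    using r by simp
  also have "\<dots> = 2 ^ r"
    by (simp add: powr_realpow)
  finally have "x \<le> 2 ^ r" .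
  moreover have "2 ^ r = 2 powr real r"
    by (simp add: powr_realpow)
  moreover have "\<dots> \<le> 2 powr (log 2 x + 1)"
    using r by simp
  moreover have "\<dots> = 2 * x"
    using assms by (simp add: powr_add)
  ultimately have "2 ^ r \<le> 2 * x"
    by (simp only:)
  with \<open>x \<le> 2 ^ r\<close> show ?thesis by blast
qed

text \<open>The quantitative core, stated with cubes so that no cube root of \<open>K\<close>
  appears.\<close>

lemma large_energy_Span:
  fixes A :: "'a::ab_group_add set" and K :: real
  assumes A: "finite A" "2 \<le> card A" and K: "1 \<le> K"
    and energy: "card A ^ 3 / K \<le> (l2norm (ind A ^ 2))\<^sup>2"
  shows "\<exists>L. finite L \<and> card L \<le> 576 * K * log 2 (card A) \<and> card A ^ 3 / (8 * K) \<le> card (Span L \<inter> A) ^ 3"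
proof -
  define N where "N = real (card A)"
  define X where "X = l2norm (ind A ^ 2)"
  \<comment> \<open>With 576 = 24^2, the inequality \<open>576 * K * log 2 N \<le> l\<close> is
    exactly what makes the removed part contribute at most a quarter of \<open>X\<close>.\<close>
  define l where "l = nat \<lceil>576 * K * log 2 N\<rceil>"
  have N: "2 \<le> N"
    using A by (simp add: N_def)
  then have log: "1 \<le> log 2 N"
    by (simp add: le_log_iff)
  have l: "576 * K * log 2 N \<le> l" "l < 576 * K * log 2 N + 1"
    using K log unfolding l_def by (auto simp: ceiling_correct intro: real_nat_ceiling_ge) linarith+
  have "log 2 N \<le> K * log 2 N"
    using K log by (simp add: mult_le_cancel_right1)
  then have l_ge: "576 * log 2 N \<le> l"
    using l by linarith
  then have "0 < l"
    using log by linarith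
  obtain r :: nat where r: "log 2 N \<le> 2 ^ r" "2 ^ r \<le> 2 * log 2 N"
    using exists_power_of_two_between [OF log] by blast
  \<comment> \<open>The lower bound \<open>log 2 N\<close> gives \<open>card A \<le> 2 ^ k\<close>;
    the upper bound \<open>2 * log 2 N\<close> keeps the loss logarithmic.\<close>
  define k :: nat where "k = 2 ^ r"
  have k: "log 2 N \<le> k" "k \<le> 2 * log 2 N"
    using r by (simp_all add: k_def)
  have "k \<le> l"
    using k l_ge log by linarith
  have "card A \<le> 2 ^ k"
  proof -
    have "N = 2 powr log 2 N"
      using N by simp
    also have "\<dots> \<le> 2 powr k"
      using k by simp
    finally have "real (card A) \<le> real (2 ^ k)"
      by (simp add: powr_realpow N_def)
    then show ?thesis
      by (simp only: of_nat_le_iff)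
  qed
  have "l2norm (ind L * ind A) \<le> 6 * sqrt (l * N * log 2 N)"
    if "L \<subseteq> A" "dissociated L" "card L = l" for L
  proof -
    have "l2norm (ind L * ind A) \<le> 3 * sqrt (2 * k * card L * card A)"
      using that A \<open>card A \<le> 2 ^ k\<close> \<open>k \<le> l\<close>
      by (intro l2norm_dissociated_times [where r = r]) (auto simp: k_def intro: finite_subset)
    also have "\<dots> = 3 * sqrt (2 * k * l * N)"
      using that by (simp add: N_def)
    also have "\<dots> \<le> 3 * sqrt (2\<^sup>2 * (l * N * log 2 N))"
      using k N mult_right_mono [of "real k" "2 * log 2 N" "2 * l * N"]
      by (simp add: ac_simps)
    also have "\<dots> = 6 * sqrt (l * N * log 2 N)"
      by (simp only: real_sqrt_mult [of "2\<^sup>2"]) simp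
    finally show ?thesis .
  qed
  from exists_dissociated_free_subset [OF A(1) \<open>0 < l\<close> this]
  obtain B where B: "B \<subseteq> A" "\<forall>L\<subseteq>B. dissociated L \<longrightarrow> card L \<noteq> l"
    "l * l2norm (ind (A - B) * ind A) \<le> card (A - B) * (6 * sqrt (l * N * log 2 N))"
    by blast
  have finB: "finite B"
    using A B finite_subset by blast
  have X: "sqrt (N ^ 3 / K) \<le> X"
    using energy unfolding X_def N_def by (intro real_le_lsqrt) simp_all
  have "0 < X"
    using X N K by (smt (verit) divide_pos_pos real_sqrt_gt_0_iff zero_less_power)
  have small: "l2norm (ind (A - B) * ind A) \<le> X / 4"
  proof -
    have "l * l2norm (ind (A - B) * ind A) \<le> N * (6 * sqrt (l * N * log 2 N))"
      using B(3) by (rule order_trans)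
        (use A N log in \<open>auto simp: N_def intro!: mult_right_mono card_mono\<close>)
    also have "\<dots> = 6 * sqrt (N\<^sup>2 * (l * N * log 2 N))"
      using N by (simp add: real_sqrt_mult)
    \<comment> \<open>After cancelling common factors this is the choice of
      \<open>l\<close>.\<close>
    also have "\<dots> \<le> 6 * sqrt ((l / 24)\<^sup>2 * (N ^ 3 / K))"
    proof -
      have "576 * K * log 2 N * (l * N ^ 3) \<le> l * (l * N ^ 3)"
        using l N by (intro mult_right_mono) auto
      then show ?thesis
        using K by (simp add: field_simps power2_eq_square power3_eq_cube)
    qed
    also have "\<dots> = l / 4 * sqrt (N ^ 3 / K)"
      by (simp only: real_sqrt_mult) simp
    also have "\<dots> \<le> l * (X / 4)"
      using X by (simp add: mult_left_mono)
    finally show ?thesis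
      using \<open>0 < l\<close> by simp
  qed
  have "ind A = ind B + ind (A - B)"
    using A B unfolding ind_def by (metis add.commute sum.subset_diff)
  then have "X \<le> l2norm (ind B * ind A) + l2norm (ind (A - B) * ind A)"
    using l2norm_add [of "ind B * ind A" "ind (A - B) * ind A"]
    by (simp add: X_def power2_eq_square flip: distrib_right)
  then have "3 / 4 * X \<le> l2norm (ind B * ind A)"
    using small by simp
  then have "(3 / 4 * X)\<^sup>2 \<le> (l2norm (ind B * ind A))\<^sup>2"
    using \<open>0 < X\<close> by (intro power_mono) auto
  also have "\<dots> \<le> l2norm (ind B ^ 2) * X"
    unfolding X_def by (rule l2norm_mult_power2_le)
  finally have "9 / 16 * X \<le> l2norm (ind B ^ 2)"
    using \<open>0 < X\<close> by (simp add: power2_eq_square)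
  then have "(9 / 16 * X)\<^sup>2 \<le> (l2norm (ind B ^ 2))\<^sup>2"
    using \<open>0 < X\<close> by (intro power_mono) auto
  also have "\<dots> \<le> card B ^ 3"
    using energy_le_card_cube [OF finB] by simp
  \<comment> \<open>81/256 = (3/4)^4, as the factor 3/4 has been squared twice; it exceeds
    1/8.\<close>
  finally have "81 / 256 * X\<^sup>2 \<le> card B ^ 3"
    by (simp add: power_mult_distrib power2_eq_square)
  moreover have "N ^ 3 / K \<le> X\<^sup>2" "0 \<le> N ^ 3 / K"
    using energy N K by (simp_all add: X_def N_def)
  moreover have "N ^ 3 / (8 * K) = 1 / 8 * (N ^ 3 / K)"
    by simp
  ultimately have "N ^ 3 / (8 * K) \<le> card B ^ 3"
    by linarith
  moreover from dissociated_free_subset_Span [OF finB B(2)]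
  obtain L where L: "finite L" "card L < l" "B \<subseteq> Span L"
    by blast
  \<comment> \<open>The strict inequality \<open>card L < l\<close> absorbs the rounding up in
    \<open>l\<close>.\<close>
  moreover have "card L \<le> 576 * K * log 2 N"
    using L(2) l by linarith
  moreover have "real (card B) ^ 3 \<le> real (card (Span L \<inter> A)) ^ 3"
    using L(3) B(1) A(1) by (intro power_mono) (auto intro!: card_mono)
  ultimately have "N ^ 3 / (8 * K) \<le> card (Span L \<inter> A) ^ 3"
    by (simp only: of_nat_power)
  with L(1) \<open>card L \<le> 576 * K * log 2 N\<close> show ?thesis
    unfolding N_def of_nat_power by blast
qed

theorem theorem1p5:
  fixes A :: "'a::ab_group_add set" and K \<epsilon> :: real
  assumes "0 < \<epsilon>" and "\<epsilon> \<le> 1 / 2"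
    and "finite A"
    and "real (card A) \<ge> 2 powr (32 / \<epsilon>)"
    and "1 \<le> K"
    and "K \<le> min ((2 powi (-58) * \<epsilon> powi (-4) * (real (card A) / log 2 (real (card A))))
                       powr (inverse (3 / 2 + \<epsilon>)))
                  (real (card A) powr \<epsilon>)"
    and "real (card {(a\<^sub>1, a\<^sub>2, a\<^sub>3, a\<^sub>4). a\<^sub>1 \<in> A \<and> a\<^sub>2 \<in> A \<and> a\<^sub>3 \<in> A \<and> a\<^sub>4 \<in> A \<and>
                    a\<^sub>1 + a\<^sub>2 = a\<^sub>3 + a\<^sub>4})
         \<ge> real (card A) ^ 3 / K"
  shows "\<exists>\<Lambda> :: 'a set. finite \<Lambda> \<and>
           real (card (Span \<Lambda> \<inter> A)) \<ge> 1 / 2 * (real (card A) / K powr (1 / 2 + \<epsilon>)) \<and>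
           real (card \<Lambda>) \<le> 2 ^ 30 * \<epsilon> powi (-2) * K * log 2 (real (card A))"
proof -
  have "2 powr 1 \<le> 2 powr (32 / \<epsilon>)"
    using assms(1,2) by (intro powr_mono) (auto simp: field_simps)
  then have N: "2 \<le> real (card A)"
    using assms(4) by simp
  then have card: "2 \<le> card A"
    by linarith
  obtain L where L: "finite L" "card L \<le> 576 * K * log 2 (card A)"
    "card A ^ 3 / (8 * K) \<le> card (Span L \<inter> A) ^ 3"
    using large_energy_Span [OF assms(3) card assms(5)] assms(7) l2norm_ind_square [OF assms(3)]
    by auto
  have "1 / 2 * (real (card A) / K powr (1 / 2 + \<epsilon>)) \<le> card (Span L \<inter> A)"
  proof (rule power_le_imp_le_base)
    \<comment> \<open>Cubes are compared: since \<open>3 * (1 / 2 + \<epsilon>)\<close> exceeds 1,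
      the cube of \<open>K powr (1 / 2 + \<epsilon>)\<close> is at least \<open>K\<close>.\<close>
    have "K powr 1 \<le> K powr (3 * (1 / 2 + \<epsilon>))"
      using assms(1,5) by (intro powr_mono) auto
    also have "\<dots> = (K powr (1 / 2 + \<epsilon>)) ^ 3"
      using powr_powr [of K "1 / 2 + \<epsilon>" 3] assms(5) by (simp add: mult.commute)
    finally have "card A ^ 3 / (8 * (K powr (1 / 2 + \<epsilon>)) ^ 3) \<le> card A ^ 3 / (8 * K)"
      using assms(5) by (intro divide_left_mono) auto
    then show "(1 / 2 * (real (card A) / K powr (1 / 2 + \<epsilon>))) ^ Suc 2 \<le> real (card (Span L \<inter> A)) ^ Suc 2"
      using L(3) by (simp add: power_mult_distrib power_divide numeral_3_eq_3 numeral_2_eq_2)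
  qed simp
  moreover have "real (card L) \<le> 2 ^ 30 * \<epsilon> powi (-2) * K * log 2 (card A)"
  proof -
    have "\<epsilon>\<^sup>2 \<le> 1"
      using assms(1,2) by (intro power_le_one) auto
    then have "1 \<le> \<epsilon> powi (-2)"
      using assms(1) by (simp add: power_int_minus one_le_inverse_iff)
    then have "576 * K * log 2 (card A) \<le> (2 ^ 30 * \<epsilon> powi (-2)) * K * log 2 (card A)"
      using assms(5) N by (intro mult_right_mono) auto
    then show ?thesis
      using L(2) by linarith
  qed
  ultimately show ?thesis
    using L(1) by blast
qed

end
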